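(* Let $K$ be a field, let $A\in M_{n\times n}(K)$, let $\sigma_1$ be an arbitrary linear functional on $M_{n\times n}(K)$ which vanishes on the identity matrix ${\rm Id}_{n\times n}$, and let $\sigma_j$, $2\le j\le n-1$, be the polynomial functions defined recursively by $$\begin{aligned}\sigma_1(A^2)&=\sigma_1(A)\,\mathrm{tr}(A)-\sigma_2(A),\\ \sigma_1(A^3)&=\sigma_1(A)\,\mathrm{tr}(S^2A)-\sigma_2(A)\,\mathrm{tr}(A)+\sigma_3(A),\\ &\ \ \vdots\\ \sigma_1(A^{n-1})&=\sigma_1(A)\,\mathrm{tr}(S^{n-2}A)-\sigma_2(A)\,\mathrm{tr}(S^{n-3}A)+\cdots+(-1)^{n-2}\sigma_{n-1}(A).\end{aligned}$$ Then $$\sigma_1(A^{k+1}) = \sigma_1(A)\,\mathrm{tr}(S^{k} A) - \sigma_2(A)\,\mathrm{tr}(S^{k-1} A)+\cdots+(-1)^{n-2}\sigma_{n-1}(A)\,\mathrm{tr}(S^{k-n+2}A)$$ for arbitrary $k\in\mathbb{Z}$. Furthermore, if $\sigma_1(A)\neq 0$, $$\mathrm{tr}(S^{k} A)=\frac{1}{\sigma_1(A)}\Big[\sigma_1(A^{k+1})+\sigma_2(A)\,\mathrm{tr}(S^{k-1}A)+\cdots+(-1)^{n-1}\sigma_{n-1}(A)\,\mathrm{tr}(S^{k-n+2}A)\Big].$$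
   Context: $M_{n\times n}(K)$ is the space of $n\times n$ matrices with coefficients in $K$, and $\mathrm{tr}$ is the trace. $S^kA$ denotes the $k$-th symmetric power of $A$, i.e. the operator induced by $A$ on the $k$-th symmetric power $S^kV$ of $V=K^n$ (the matrix giving the induced transformation on homogeneous polynomials of degree $k$), with $\mathrm{tr}(S^{-s}A)=0$ for $s\ge 1$. In the recursive definition, the equation for $\sigma_1(A^m)$, $m=2,\ldots,n-1$, determines $\sigma_m(A)$ from the preceding functions.
   Formalization: Both formulas are proved for integers k ≥ −1 rather than all k ∈ ℤ: for k ≤ −2, with tr(S^{-s}A)=0 for s ≥ 1, they fail (n=2, A=((1,1),(0,1)), σ_1(B)=B_{12}, k=−2 gives −1=0), and A^{k+1} is undefined for singular A. *)

theory Defs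
  imports "Jordan_Normal_Form.Matrix" "HOL-Library.Poly_Mapping"
begin

definition linear_functional_mat :: "nat \<Rightarrow> ('a::field mat \<Rightarrow> 'a) \<Rightarrow> bool" where
  "linear_functional_mat n f \<longleftrightarrow>
     (\<forall>A\<in>carrier_mat n n. \<forall>B\<in>carrier_mat n n. f (A + B) = f A + f B) \<and>
     (\<forall>c. \<forall>A\<in>carrier_mat n n. f (c \<cdot>\<^sub>m A) = c * f A)"

text \<open>
  A polynomial in the variables \<open>x\<^sub>0, x\<^sub>1, \<dots>\<close> is a finitely supported map from exponent vectors
  to coefficients. For \<open>V = K^n\<close> with standard basis \<open>e\<^sub>0, \<dots>, e\<^sub>n\<^sub>-\<^sub>1\<close> (indexed from 0, as matrices
  are), the symmetric power \<open>S^k V\<close> is the space of homogeneous polynomials of degree \<open>k\<close> in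
  \<open>x\<^sub>0, \<dots>, x\<^sub>n\<^sub>-\<^sub>1\<close>, where \<open>x\<^sub>j\<close> stands for \<open>e\<^sub>j\<close>.
\<close>

type_synonym 'a mpolynomial = "(nat \<Rightarrow>\<^sub>0 nat) \<Rightarrow>\<^sub>0 'a"

text \<open>Exponents of the monomial basis of \<open>S^k V\<close>.\<close>

definition exponents :: "nat \<Rightarrow> nat \<Rightarrow> (nat \<Rightarrow>\<^sub>0 nat) set" where
  "exponents n k = {\<alpha>. Poly_Mapping.keys \<alpha> \<subseteq> {..<n} \<and> (\<Sum>i<n. Poly_Mapping.lookup \<alpha> i) = k}"

text \<open>The linear form \<open>A e\<^sub>j = (\<Sum>i<n. A\<^sub>i\<^sub>j e\<^sub>i)\<close>.\<close>

definition image_var :: "'a::field mat \<Rightarrow> nat \<Rightarrow> 'a mpolynomial" where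
  "image_var A j = (\<Sum>i<dim_row A. Poly_Mapping.single (Poly_Mapping.single i 1) (A $$ (i, j)))"

text \<open>
  The endomorphism of the symmetric algebra of \<open>V\<close> induced by \<open>A\<close>, that is, the substitution
  \<open>x\<^sub>j \<mapsto> A e\<^sub>j\<close>. It preserves degrees, and its restriction to degree \<open>k\<close> is the operator \<open>S^k A\<close>.
\<close>

definition sym_power_op :: "'a::field mat \<Rightarrow> 'a mpolynomial \<Rightarrow> 'a mpolynomial" where
  "sym_power_op A p =
     (\<Sum>\<beta>\<in>Poly_Mapping.keys p. Poly_Mapping.single 0 (Poly_Mapping.lookup p \<beta>) *
        (\<Prod>j<dim_row A. image_var A j ^ Poly_Mapping.lookup \<beta> j))"

text \<open>Entry \<open>(\<alpha>, \<beta>)\<close> of the matrix of \<open>S^k A\<close> in the monomial basis of \<open>S^k V\<close>.\<close>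

definition sym_power_entry :: "'a::field mat \<Rightarrow> (nat \<Rightarrow>\<^sub>0 nat) \<Rightarrow> (nat \<Rightarrow>\<^sub>0 nat) \<Rightarrow> 'a" where
  "sym_power_entry A \<alpha> \<beta> = Poly_Mapping.lookup (sym_power_op A (Poly_Mapping.single \<beta> 1)) \<alpha>"

text \<open>
  The trace of \<open>S^k A\<close>, with the convention that it is 0 for all negative \<open>k\<close>. Because of this
  convention, an identity of the form \<open>\<sigma>\<^sub>1(A^(k+1)) = \<sigma>\<^sub>1(A) tr(S^k A) - \<sigma>\<^sub>2(A) tr(S^(k-1) A) + \<dots>\<close>
  cannot hold with inverse powers of \<open>A\<close>: for \<open>n = 2\<close>, \<open>k = -2\<close>, \<open>A = ((1,1),(0,1))\<close> and
  \<open>\<sigma>\<^sub>1(B) = B\<^sub>0\<^sub>1\<close>, the left side is \<open>-1\<close> and the right side is 0.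
\<close>

definition tr_sym_power :: "'a::field mat \<Rightarrow> int \<Rightarrow> 'a" where
  "tr_sym_power A k =
     (if k < 0 then 0 else \<Sum>\<alpha>\<in>exponents (dim_row A) (nat k). sym_power_entry A \<alpha> \<alpha>)"

end

theory Submission
  imports Defs "Jordan_Normal_Form.Char_Poly" "Jordan_Normal_Form.DL_Rank" "Jordan_Normal_Form.Schur_Decomposition"
    "HOL-Algebra.Algebraic_Closure_Type" "HOL-Computational_Algebra.Polynomial_FPS"
begin

text \<open>
  Put \<open>D(t) = det (1 - t A)\<close>, \<open>H(t) = \<Sum>\<^sub>k tr (S^k A) t^k\<close>, \<open>a(t) = \<Sum>\<^sub>m \<sigma>\<^sub>1(A^m) t^m\<close> and
  \<open>P(t) = \<Sum>\<^sub>i (-1)^(i-1) \<sigma>\<^sub>i(A) t^i\<close> with \<open>1 \<le> i \<le> n - 1\<close>; the claim is \<open>a = P H\<close>. One has \<open>H D = 1\<close>: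
  over the algebraic closure \<open>A\<close> is similar to a triangular matrix, whose \<open>tr (S^k)\<close> is the complete
  homogeneous symmetric polynomial of the diagonal entries. Since \<open>D(t) (1 - t A)\<^sup>-\<^sup>1\<close> is the adjugate
  of \<open>1 - t A\<close>, whose entries have degree less than \<open>n\<close>, the series \<open>D a\<close> is a polynomial of degree less than \<open>n\<close>.
  The recursion says that \<open>a\<close> and \<open>P H\<close>, hence also \<open>D a\<close> and \<open>P\<close>, agree up to degree \<open>n - 1\<close>.
  Therefore \<open>D a = P\<close>.
\<close>

section \<open>The induced endomorphism of the symmetric algebra\<close>

text \<open>A finitely supported map is the finite sum of its terms. This reduces identities that
  are additive in a polynomial to monomials.\<close>

lemma poly_mapping_add_induct [case_names single add]:
  assumes "\<And>k c. P (Poly_Mapping.single k c)" and "\<And>p q. P p \<Longrightarrow> P q \<Longrightarrow> P (p + q)"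
  shows "P (p :: 'k \<Rightarrow>\<^sub>0 'b::comm_monoid_add)"
proof -
  have P_sum: "P (\<Sum>k\<in>S. Poly_Mapping.single k (Poly_Mapping.lookup p k))" if "finite S" for S
    using that
  proof induction
    case empty
    \<comment> \<open>\<open>single undefined 0\<close> is the zero map, the value of the empty
      sum.\<close>
    show ?case using assms(1)[of undefined 0] by simp
  qed (use assms in auto)
  have "p = (\<Sum>k\<in>Poly_Mapping.keys p. Poly_Mapping.single k (Poly_Mapping.lookup p k))"
    by (rule poly_mapping_eqI)
      (auto simp: lookup_sum lookup_single when_def in_keys_iff)
  then show ?thesis using P_sum[of "Poly_Mapping.keys p"] by simp
qed

abbreviation (input) monomial_image :: "'a::field mat \<Rightarrow> (nat \<Rightarrow>\<^sub>0 nat) \<Rightarrow> 'a mpolynomial" where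
  "monomial_image A \<beta> \<equiv> (\<Prod>j<dim_row A. image_var A j ^ Poly_Mapping.lookup \<beta> j)"

text \<open>Indices outside the keys contribute coefficient 0, so polynomials with different
  supports can be summed over one common set.\<close>

lemma sym_power_op_superset:
  assumes "finite S" "Poly_Mapping.keys p \<subseteq> S"
  shows "sym_power_op A p =
    (\<Sum>\<beta>\<in>S. Poly_Mapping.single 0 (Poly_Mapping.lookup p \<beta>) * monomial_image A \<beta>)"
  unfolding sym_power_op_def
  by (rule sum.mono_neutral_left) (use assms in \<open>auto simp: in_keys_iff\<close>)

lemma sym_power_op_single:
  "sym_power_op A (Poly_Mapping.single \<beta> c) = Poly_Mapping.single 0 c * monomial_image A \<beta>"
  by (subst sym_power_op_superset[of "{\<beta>}"]) auto

lemma sym_power_op_add: "sym_power_op A (p + q) = sym_power_op A p + sym_power_op A q"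
proof -
  let ?S = "Poly_Mapping.keys p \<union> Poly_Mapping.keys q"
  have "Poly_Mapping.keys (p + q) \<subseteq> ?S"
    by (rule Poly_Mapping.keys_add)
  then show ?thesis
    by (subst (1 2 3) sym_power_op_superset[of ?S])
      (auto simp: lookup_add single_add algebra_simps sum.distrib)
qed

text \<open>Both sides are additive in \<open>p\<close> and in \<open>q\<close>; on monomials the
  exponents add.\<close>

lemma sym_power_op_mult: "sym_power_op A (p * q) = sym_power_op A p * sym_power_op A q"
proof (induction p rule: poly_mapping_add_induct)
  case (single k c)
  show ?case
  proof (induction q rule: poly_mapping_add_induct)
    case (single l d)
    have "monomial_image A (k + l) = monomial_image A k * monomial_image A l"
      by (simp add: lookup_add power_add prod.distrib)
    moreover have "Poly_Mapping.single 0 (c * d) =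
        (Poly_Mapping.single 0 c * Poly_Mapping.single 0 d :: 'a mpolynomial)"
      by (simp add: mult_single)
    ultimately show ?case
      by (simp add: mult_single sym_power_op_single mult_ac)
  qed (simp add: sym_power_op_add algebra_simps)
qed (simp add: sym_power_op_add algebra_simps)

lemma sym_power_op_one: "sym_power_op A 1 = 1"
  using sym_power_op_single[of A 0 1] by simp

lemma sym_power_op_power: "sym_power_op A (p ^ k) = sym_power_op A p ^ k"
  by (induction k) (simp_all add: sym_power_op_one sym_power_op_mult)

lemma sym_power_op_prod: "sym_power_op A (\<Prod>x\<in>S. f x) = (\<Prod>x\<in>S. sym_power_op A (f x))"
  by (induction S rule: infinite_finite_induct) (simp_all add: sym_power_op_one sym_power_op_mult)

lemma sym_power_op_sum: "sym_power_op A (\<Sum>x\<in>S. f x) = (\<Sum>x\<in>S. sym_power_op A (f x))"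
  by (induction S rule: infinite_finite_induct) (simp_all add: sym_power_op_add, simp_all add: sym_power_op_def)

lemma sym_power_entry_eq: "sym_power_entry A \<alpha> \<beta> = Poly_Mapping.lookup (monomial_image A \<beta>) \<alpha>"
  by (simp add: sym_power_entry_def sym_power_op_single)

lemma lookup_single_0_mult:
  "Poly_Mapping.lookup (Poly_Mapping.single 0 c * p) k = c * Poly_Mapping.lookup (p :: 'a::comm_semiring_1 mpolynomial) k"
  by (simp add: mult_map_scale_conv_mult[symmetric] Poly_Mapping.map.rep_eq when_def)

lemma single_sum: "Poly_Mapping.single k (\<Sum>x\<in>S. f x) = (\<Sum>x\<in>S. Poly_Mapping.single k (f x))"
  by (induction S rule: infinite_finite_induct) (simp_all add: single_add)

text \<open>Exchanging the two sums turns each coefficient into an entry of the matrix product. As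
  \<open>sym_power_op A\<close> is multiplicative, this case of generators yields functoriality on
  all monomials.\<close>

lemma sym_power_op_image_var:
  assumes A: "A \<in> carrier_mat n n" and B: "B \<in> carrier_mat n n" and j: "j < n"
  shows "sym_power_op A (image_var B j) = image_var (A * B) j"
proof -
  have img: "monomial_image A (Poly_Mapping.single i 1) = image_var A i" if "i < n" for i
  proof -
    have "monomial_image A (Poly_Mapping.single i 1) = (\<Prod>j<n. if j = i then image_var A i else 1)"
      using A by (intro prod.cong) (auto simp: lookup_single when_def)
    then show ?thesis using that by simp
  qed
  have "sym_power_op A (image_var B j) =
      (\<Sum>i<n. Poly_Mapping.single 0 (B $$ (i, j)) * image_var A i)"
    using B by (auto simp: image_var_def[of B] sym_power_op_sum sym_power_op_single img
      intro!: sum.cong simp del: One_nat_def)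
  also have "\<dots> = (\<Sum>i<n. \<Sum>l<n. Poly_Mapping.single (Poly_Mapping.single l 1) (A $$ (l, i) * B $$ (i, j)))"
    using A by (simp add: image_var_def sum_distrib_left mult_single mult_ac)
  also have "\<dots> = (\<Sum>l<n. Poly_Mapping.single (Poly_Mapping.single l 1) (\<Sum>i<n. A $$ (l, i) * B $$ (i, j)))"
    by (subst sum.swap) (simp add: single_sum)
  also have "\<dots> = image_var (A * B) j"
    using A B j by (auto simp: image_var_def scalar_prod_def atLeast0LessThan intro!: sum.cong)
  finally show ?thesis .
qed

section \<open>Functoriality and the trace\<close>

lemma exponents_add:
  assumes "\<alpha> \<in> exponents n k" "\<beta> \<in> exponents n l"
  shows "\<alpha> + \<beta> \<in> exponents n (k + l)"
  using assms Poly_Mapping.keys_add[of \<alpha> \<beta>]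
  by (auto simp: exponents_def lookup_add sum.distrib)

lemma zero_in_exponents: "0 \<in> exponents n 0"
  by (simp add: exponents_def)

lemma single_in_exponents: "i < n \<Longrightarrow> Poly_Mapping.single i k \<in> exponents n k"
  by (auto simp: exponents_def lookup_single when_def)

text \<open>No single exponent exceeds the total degree, so exponent vectors inject into a finite
  set of functions.\<close>

lemma finite_exponents: "finite (exponents n k)"
proof -
  have "Poly_Mapping.lookup ` exponents n k \<subseteq>
      {f. \<forall>i. (i \<in> {..<n} \<longrightarrow> f i \<in> {..k}) \<and> (i \<notin> {..<n} \<longrightarrow> f i = 0)}"
  proof (rule image_subsetI)
    fix \<alpha>
    assume \<alpha>: "\<alpha> \<in> exponents n k"
    have "Poly_Mapping.lookup \<alpha> i \<le> k" if "i < n" for i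
      using \<alpha> that member_le_sum[of i "{..<n}" "Poly_Mapping.lookup \<alpha>"]
      by (auto simp: exponents_def)
    moreover have "Poly_Mapping.lookup \<alpha> i = 0" if "\<not> i < n" for i
      using \<alpha> that by (auto simp: exponents_def in_keys_iff)
    ultimately show "Poly_Mapping.lookup \<alpha> \<in>
        {f. \<forall>i. (i \<in> {..<n} \<longrightarrow> f i \<in> {..k}) \<and> (i \<notin> {..<n} \<longrightarrow> f i = 0)}"
      by simp
  qed
  moreover have "finite {f. \<forall>i. (i \<in> {..<n} \<longrightarrow> f i \<in> {..k}) \<and> (i \<notin> {..<n} \<longrightarrow> f i = 0)}"
    by (rule finite_set_of_finite_funs) auto
  ultimately have "finite (Poly_Mapping.lookup ` exponents n k)"
    by (rule finite_subset)
  then show ?thesis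
    by (rule finite_imageD) (auto intro: inj_onI poly_mapping_eqI)
qed

text \<open>Having all keys in \<open>exponents n k\<close> expresses homogeneity of degree
  \<open>k\<close> in the first \<open>n\<close> variables.\<close>

lemma keys_mult_subset_exponents:
  assumes "Poly_Mapping.keys p \<subseteq> exponents n k" "Poly_Mapping.keys q \<subseteq> exponents n l"
  shows "Poly_Mapping.keys (p * q) \<subseteq> exponents n (k + l)"
  using assms Poly_Mapping.keys_mult[of p q] by (fastforce intro: exponents_add)

lemma keys_power_subset_exponents:
  assumes "Poly_Mapping.keys p \<subseteq> exponents n k"
  shows "Poly_Mapping.keys (p ^ m) \<subseteq> exponents n (m * k)"
  by (induction m) (simp_all add: zero_in_exponents keys_mult_subset_exponents[OF assms])

lemma keys_prod_subset_exponents: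
  assumes "\<And>x. x \<in> S \<Longrightarrow> Poly_Mapping.keys (f x) \<subseteq> exponents n (d x)" "finite S"
  shows "Poly_Mapping.keys (\<Prod>x\<in>S. f x) \<subseteq> exponents n (\<Sum>x\<in>S. d x)"
  using assms(2,1)
  by induction (simp_all add: zero_in_exponents keys_mult_subset_exponents)

lemma keys_image_var:
  assumes "A \<in> carrier_mat n n"
  shows "Poly_Mapping.keys (image_var A j) \<subseteq> exponents n 1"
proof -
  have "Poly_Mapping.keys (image_var A j) \<subseteq>
      (\<Union>i<n. Poly_Mapping.keys (Poly_Mapping.single (Poly_Mapping.single i (1::nat)) (A $$ (i, j))))"
    unfolding image_var_def carrier_matD(1)[OF assms] by (rule Poly_Mapping.keys_sum)
  also have "\<dots> \<subseteq> exponents n 1"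
    using single_in_exponents[of _ n 1] by (auto split: if_splits)
  finally show ?thesis .
qed

lemma keys_monomial_image:
  assumes A: "A \<in> carrier_mat n n" and \<beta>: "\<beta> \<in> exponents n k"
  shows "Poly_Mapping.keys (monomial_image A \<beta>) \<subseteq> exponents n k"
proof -
  have "Poly_Mapping.keys (monomial_image A \<beta>) \<subseteq>
      exponents n (\<Sum>j<dim_row A. Poly_Mapping.lookup \<beta> j * 1)"
    by (intro keys_prod_subset_exponents keys_power_subset_exponents keys_image_var A) simp
  then show ?thesis
    using A \<beta> by (simp add: exponents_def)
qed

text \<open>The image of a monomial under \<open>B\<close> is homogeneous of the same degree, so it
  can be expanded over \<open>exponents n k\<close> before \<open>A\<close> is applied.\<close>

lemma sym_power_entry_mult:
  assumes A: "A \<in> carrier_mat n n" and B: "B \<in> carrier_mat n n"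
    and \<beta>: "\<beta> \<in> exponents n k"
  shows "sym_power_entry (A * B) \<alpha> \<beta> =
    (\<Sum>\<gamma>\<in>exponents n k. sym_power_entry A \<alpha> \<gamma> * sym_power_entry B \<gamma> \<beta>)"
proof -
  have "monomial_image (A * B) \<beta> = sym_power_op A (monomial_image B \<beta>)"
    using A B by (simp add: sym_power_op_prod sym_power_op_power sym_power_op_image_var)
  also have "\<dots> = (\<Sum>\<gamma>\<in>exponents n k.
      Poly_Mapping.single 0 (Poly_Mapping.lookup (monomial_image B \<beta>) \<gamma>) * monomial_image A \<gamma>)"
    by (rule sym_power_op_superset[OF finite_exponents keys_monomial_image[OF B \<beta>]])
  finally show ?thesis
    by (simp add: sym_power_entry_eq lookup_sum lookup_single_0_mult, simp add: mult.commute)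
qed

lemma tr_sym_power_eq:
  "A \<in> carrier_mat n n \<Longrightarrow> tr_sym_power A (int k) = (\<Sum>\<alpha>\<in>exponents n k. sym_power_entry A \<alpha> \<alpha>)"
  by (simp add: tr_sym_power_def)

lemma tr_sym_power_neg: "k < 0 \<Longrightarrow> tr_sym_power A k = 0"
  by (simp add: tr_sym_power_def)

text \<open>The usual argument for \<open>tr (X Y) = tr (Y X)\<close>, applied to the matrices of
  \<open>S^k A\<close> and \<open>S^k B\<close>.\<close>

lemma tr_sym_power_mult_comm:
  assumes A: "A \<in> carrier_mat n n" and B: "B \<in> carrier_mat n n"
  shows "tr_sym_power (A * B) (int k) = tr_sym_power (B * A) (int k)"
proof -
  have "tr_sym_power (A * B) (int k) =
      (\<Sum>\<alpha>\<in>exponents n k. \<Sum>\<gamma>\<in>exponents n k. sym_power_entry A \<alpha> \<gamma> * sym_power_entry B \<gamma> \<alpha>)"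
    by (subst tr_sym_power_eq[of _ n]) (use A B in \<open>auto intro!: sum.cong sym_power_entry_mult\<close>)
  also have "\<dots> = (\<Sum>\<gamma>\<in>exponents n k. \<Sum>\<alpha>\<in>exponents n k. sym_power_entry B \<gamma> \<alpha> * sym_power_entry A \<alpha> \<gamma>)"
    by (subst sum.swap) (simp add: mult.commute)
  also have "\<dots> = tr_sym_power (B * A) (int k)"
    by (subst tr_sym_power_eq[of _ n])
      (use A B in \<open>auto intro!: sum.cong sym_power_entry_mult[symmetric]\<close>)
  finally show ?thesis .
qed

lemma tr_sym_power_similar:
  assumes "similar_mat A B"
  shows "tr_sym_power A (int k) = tr_sym_power B (int k)"
proof -
  from similar_matD[OF assms] obtain n P Q where
    carr: "{A, B, P, Q} \<subseteq> carrier_mat n n" and QP: "Q * P = 1\<^sub>m n" and AB: "A = P * B * Q"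
    by blast
  then have B: "B \<in> carrier_mat n n" and P: "P \<in> carrier_mat n n" and Q: "Q \<in> carrier_mat n n"
    by auto
  have "tr_sym_power A (int k) = tr_sym_power (Q * (P * B)) (int k)"
    unfolding AB using P B Q by (intro tr_sym_power_mult_comm[of _ n]) auto
  also have "Q * (P * B) = B"
    using B P Q QP by (simp flip: assoc_mult_mat[of _ n n _ n _ n])
  finally show ?thesis .
qed

section \<open>Upper triangular matrices\<close>

text \<open>
  If \<open>A\<close> is upper triangular, then \<open>A e\<^sub>j\<close> is \<open>A\<^sub>j\<^sub>j x\<^sub>j\<close> plus terms of smaller weight, so the diagonal
  entries of \<open>S^k A\<close> are read off as leading coefficients.
\<close>

definition weight :: "nat \<Rightarrow> (nat \<Rightarrow>\<^sub>0 nat) \<Rightarrow> nat" where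
  "weight n \<alpha> = (\<Sum>i<n. i * Poly_Mapping.lookup \<alpha> i)"

text \<open>A relation rather than a leading coefficient, because \<open>c\<close> may be 0: it
  fixes the coefficient at \<open>\<beta>\<close> and bounds the weight of all other terms.\<close>

definition leading :: "nat \<Rightarrow> 'a::comm_ring_1 \<Rightarrow> (nat \<Rightarrow>\<^sub>0 nat) \<Rightarrow> 'a mpolynomial \<Rightarrow> bool" where
  "leading n c \<beta> p \<longleftrightarrow> (\<exists>r. p = Poly_Mapping.single \<beta> c + r \<and>
     (\<forall>\<alpha>\<in>Poly_Mapping.keys r. weight n \<alpha> < weight n \<beta>))"

lemma weight_add: "weight n (\<alpha> + \<beta>) = weight n \<alpha> + weight n \<beta>"
  by (simp add: weight_def lookup_add algebra_simps sum.distrib)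

lemma weight_single: "i < n \<Longrightarrow> weight n (Poly_Mapping.single i m) = i * m"
  by (simp add: weight_def lookup_single when_def if_distrib[of "\<lambda>x. _ * x"] cong: if_cong)

lemma leading_lookup: "leading n c \<beta> p \<Longrightarrow> Poly_Mapping.lookup p \<beta> = c"
  by (auto simp: leading_def lookup_add in_keys_iff)

lemma leading_one: "leading n 1 0 1"
  unfolding leading_def by (rule exI[of _ 0]) simp

lemma leading_mult:
  assumes "leading n c \<beta> p" "leading n d \<gamma> q"
  shows "leading n (c * d) (\<beta> + \<gamma>) (p * q)"
proof -
  obtain r where p: "p = Poly_Mapping.single \<beta> c + r"
    and r: "\<And>\<alpha>. \<alpha> \<in> Poly_Mapping.keys r \<Longrightarrow> weight n \<alpha> < weight n \<beta>"
    using assms(1) unfolding leading_def by blast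
  obtain s where q: "q = Poly_Mapping.single \<gamma> d + s"
    and s: "\<And>\<alpha>. \<alpha> \<in> Poly_Mapping.keys s \<Longrightarrow> weight n \<alpha> < weight n \<gamma>"
    using assms(2) unfolding leading_def by blast
  \<comment> \<open>The three products that contain at least one remainder, hence a factor of
    strictly smaller weight.\<close>
  define t where "t = Poly_Mapping.single \<beta> c * s + (r * Poly_Mapping.single \<gamma> d + r * s)"
  have "p * q = Poly_Mapping.single (\<beta> + \<gamma>) (c * d) + t"
    by (simp add: p q t_def algebra_simps mult_single)
  moreover have "weight n \<alpha> < weight n (\<beta> + \<gamma>)" if "\<alpha> \<in> Poly_Mapping.keys t" for \<alpha>
  proof -
    have "\<alpha> \<in> Poly_Mapping.keys (Poly_Mapping.single \<beta> c * s) \<union>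
        (Poly_Mapping.keys (r * Poly_Mapping.single \<gamma> d) \<union> Poly_Mapping.keys (r * s))"
      using that Poly_Mapping.keys_add[of "Poly_Mapping.single \<beta> c * s"
          "r * Poly_Mapping.single \<gamma> d + r * s"]
        Poly_Mapping.keys_add[of "r * Poly_Mapping.single \<gamma> d" "r * s"]
      unfolding t_def by blast
    then obtain a b where "\<alpha> = a + b" and
      "a = \<beta> \<and> b \<in> Poly_Mapping.keys s \<or> a \<in> Poly_Mapping.keys r \<and> b = \<gamma> \<or>
       a \<in> Poly_Mapping.keys r \<and> b \<in> Poly_Mapping.keys s"
      using Poly_Mapping.keys_mult[of "Poly_Mapping.single \<beta> c" s]
        Poly_Mapping.keys_mult[of r "Poly_Mapping.single \<gamma> d"] Poly_Mapping.keys_mult[of r s]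
      by (auto split: if_splits)
    then show ?thesis
      using r[of a] s[of b] by (auto simp: weight_add)
  qed
  ultimately show ?thesis
    unfolding leading_def by blast
qed

lemma leading_power:
  assumes "leading n c (Poly_Mapping.single j 1) p"
  shows "leading n (c ^ m) (Poly_Mapping.single j m) (p ^ m)"
proof (induction m)
  case (Suc m)
  show ?case
    using leading_mult[OF assms Suc] by (simp flip: single_add)
qed (simp add: leading_one)

lemma leading_prod:
  assumes "\<And>x. x \<in> S \<Longrightarrow> leading n (c x) (\<beta> x) (p x)" "finite S"
  shows "leading n (\<Prod>x\<in>S. c x) (\<Sum>x\<in>S. \<beta> x) (\<Prod>x\<in>S. p x)"
  using assms(2,1) by induction (simp_all add: leading_one leading_mult)

lemma leading_image_var:
  assumes A: "A \<in> carrier_mat n n" and ut: "upper_triangular A" and j: "j < n"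
  shows "leading n (A $$ (j, j)) (Poly_Mapping.single j 1) (image_var A j)"
proof -
  let ?x = "\<lambda>i. Poly_Mapping.single (Poly_Mapping.single i (1::nat)) (A $$ (i, j))"
  have "image_var A j = ?x j + (\<Sum>i\<in>{..<n} - {j}. ?x i)"
    using A j by (simp add: image_var_def sum.remove[of "{..<n}" j])
  also have "(\<Sum>i\<in>{..<n} - {j}. ?x i) = (\<Sum>i<j. ?x i)"
    using A ut j by (intro sum.mono_neutral_right) (auto simp: upper_triangular_def)
  finally have "image_var A j = ?x j + (\<Sum>i<j. ?x i)" .
  moreover have "weight n \<alpha> < weight n (Poly_Mapping.single j 1)"
    if \<alpha>: "\<alpha> \<in> Poly_Mapping.keys (\<Sum>i<j. ?x i)" for \<alpha>
  proof -
    obtain i where "i < j" "\<alpha> = Poly_Mapping.single i 1"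
      using \<alpha> Poly_Mapping.keys_sum[of ?x "{..<j}"] by (auto split: if_splits)
    then show ?thesis
      using j by (simp add: weight_single del: One_nat_def)
  qed
  ultimately show ?thesis
    unfolding leading_def by blast
qed

text \<open>A monomial is a product of powers of variables, so multiplying the leading data of the
  linear forms gives its coefficient in its own image.\<close>

lemma sym_power_entry_diag_upper_triangular:
  assumes A: "A \<in> carrier_mat n n" and ut: "upper_triangular A" and \<beta>: "\<beta> \<in> exponents n k"
  shows "sym_power_entry A \<beta> \<beta> = (\<Prod>j<n. A $$ (j, j) ^ Poly_Mapping.lookup \<beta> j)"
proof -
  have "\<beta> = (\<Sum>j<n. Poly_Mapping.single j (Poly_Mapping.lookup \<beta> j))"
    using \<beta> by (intro poly_mapping_eqI)
      (auto simp: exponents_def lookup_sum lookup_single when_def in_keys_iff)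
  moreover have "leading n (\<Prod>j<n. A $$ (j, j) ^ Poly_Mapping.lookup \<beta> j)
      (\<Sum>j<n. Poly_Mapping.single j (Poly_Mapping.lookup \<beta> j)) (monomial_image A \<beta>)"
    using A leading_image_var[OF A ut] by (auto intro!: leading_prod leading_power simp del: One_nat_def)
  ultimately have "leading n (\<Prod>j<n. A $$ (j, j) ^ Poly_Mapping.lookup \<beta> j) \<beta> (monomial_image A \<beta>)"
    by simp
  then show ?thesis
    by (simp add: sym_power_entry_eq leading_lookup)
qed

section \<open>Complete homogeneous symmetric polynomials and their generating function\<close>

definition complete_sym :: "nat \<Rightarrow> (nat \<Rightarrow> 'a::comm_ring_1) \<Rightarrow> nat \<Rightarrow> 'a" where
  "complete_sym n d k = (\<Sum>\<alpha>\<in>exponents n k. \<Prod>j<n. d j ^ Poly_Mapping.lookup \<alpha> j)"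

lemma lookup_exponents: "\<alpha> \<in> exponents n k \<Longrightarrow> Poly_Mapping.lookup \<alpha> n = 0"
  by (auto simp: exponents_def in_keys_iff)

text \<open>Either variable \<open>n\<close> does not occur, or one factor of it can be
  removed.\<close>

lemma exponents_Suc:
  "exponents (Suc n) (Suc k) =
    exponents n (Suc k) \<union> (\<lambda>\<alpha>. \<alpha> + Poly_Mapping.single n 1) ` exponents (Suc n) k" (is "_ = _ \<union> ?R")
proof (intro equalityI subsetI)
  fix \<alpha> assume \<alpha>: "\<alpha> \<in> exponents (Suc n) (Suc k)"
  show "\<alpha> \<in> exponents n (Suc k) \<union> ?R"
  proof (cases "Poly_Mapping.lookup \<alpha> n")
    case 0
    then have "Poly_Mapping.keys \<alpha> \<subseteq> {..<Suc n} - {n}"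
      using \<alpha> by (auto simp: exponents_def in_keys_iff)
    also have "{..<Suc n} - {n} = {..<n}"
      by auto
    finally have "\<alpha> \<in> exponents n (Suc k)"
      using \<alpha> 0 by (simp add: exponents_def)
    then show ?thesis by simp
  next
    case (Suc m)
    \<comment> \<open>Subtraction of exponents is truncated; addition undoes it here because the
      exponent of \<open>n\<close> is positive.\<close>
    define \<beta> where "\<beta> = \<alpha> - Poly_Mapping.single n 1"
    have "\<alpha> = \<beta> + Poly_Mapping.single n 1"
      using Suc by (intro poly_mapping_eqI)
        (auto simp: \<beta>_def lookup_add lookup_minus lookup_single when_def)
    moreover have "\<beta> \<in> exponents (Suc n) k"
    proof -
      have "Poly_Mapping.keys \<beta> \<subseteq> {..<Suc n}"
      proof
        fix i assume "i \<in> Poly_Mapping.keys \<beta>"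
        then have "i \<in> Poly_Mapping.keys \<alpha>"
          by (auto simp: in_keys_iff \<beta>_def lookup_minus)
        then show "i \<in> {..<Suc n}"
          using \<alpha> by (auto simp: exponents_def)
      qed
      moreover have "(\<Sum>i<Suc n. Poly_Mapping.lookup \<alpha> i) = (\<Sum>i<Suc n. Poly_Mapping.lookup \<beta> i) + 1"
        unfolding \<open>\<alpha> = \<beta> + _\<close> by (simp add: lookup_add sum.distrib lookup_single when_def)
      ultimately show ?thesis
        using \<alpha> by (simp add: exponents_def)
    qed
    ultimately show ?thesis by blast
  qed
next
  fix \<alpha> assume "\<alpha> \<in> exponents n (Suc k) \<union> ?R"
  then show "\<alpha> \<in> exponents (Suc n) (Suc k)"
  proof
    assume "\<alpha> \<in> exponents n (Suc k)"
    then show ?thesis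
      using lookup_exponents[of \<alpha> n "Suc k"] by (auto simp: exponents_def)
  next
    assume "\<alpha> \<in> ?R"
    then show ?thesis
      using exponents_add[OF _ single_in_exponents[of n "Suc n" 1]] by auto
  qed
qed

lemma exponents_0_right: "exponents n 0 = {0}"
proof -
  have "\<alpha> = 0" if "\<alpha> \<in> exponents n 0" for \<alpha>
    using that by (intro poly_mapping_eqI) (auto simp: exponents_def in_keys_iff subset_iff)
  then show ?thesis
    using zero_in_exponents by blast
qed

lemma exponents_0_left: "exponents 0 (Suc k) = {}"
  by (simp add: exponents_def)

lemma complete_sym_0: "complete_sym n d 0 = 1"
  by (simp add: complete_sym_def exponents_0_right)

text \<open>The sum splits as in \<open>exponents_Suc\<close>; the parts are disjoint since only the
  shifted exponents involve variable \<open>n\<close>.\<close>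

lemma complete_sym_Suc:
  "complete_sym (Suc n) d (Suc k) = complete_sym n d (Suc k) + d n * complete_sym (Suc n) d k"
proof -
  let ?m = "\<lambda>\<alpha>. \<Prod>j<Suc n. d j ^ Poly_Mapping.lookup \<alpha> j"
  let ?s = "\<lambda>\<alpha>. \<alpha> + Poly_Mapping.single n (1::nat)"
  have disj: "exponents n (Suc k) \<inter> ?s ` exponents (Suc n) k = {}"
    using lookup_exponents[of _ n "Suc k"] by (fastforce simp: lookup_add)
  have inj: "inj_on ?s (exponents (Suc n) k)"
    by (auto intro: inj_onI)
  have shift: "?m (?s \<alpha>) = d n * ?m \<alpha>" for \<alpha>
  proof -
    have "(\<Prod>j<n. d j ^ Poly_Mapping.lookup (?s \<alpha>) j) = (\<Prod>j<n. d j ^ Poly_Mapping.lookup \<alpha> j)"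
      by (intro prod.cong) (auto simp: lookup_add lookup_single when_def)
    then show ?thesis by (simp add: lookup_add mult_ac)
  qed
  have "complete_sym (Suc n) d (Suc k) =
      (\<Sum>\<alpha>\<in>exponents n (Suc k). ?m \<alpha>) + (\<Sum>\<alpha>\<in>?s ` exponents (Suc n) k. ?m \<alpha>)"
    unfolding complete_sym_def exponents_Suc
    by (rule sum.union_disjoint) (use disj finite_exponents in auto)
  also have "(\<Sum>\<alpha>\<in>?s ` exponents (Suc n) k. ?m \<alpha>) = d n * complete_sym (Suc n) d k"
    unfolding sum.reindex[OF inj] o_def shift
    by (simp add: complete_sym_def sum_distrib_left)
  also have "(\<Sum>\<alpha>\<in>exponents n (Suc k). ?m \<alpha>) = complete_sym n d (Suc k)"
    by (simp add: complete_sym_def lookup_exponents cong: sum.cong)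
  finally show ?thesis .
qed

text \<open>By the recurrence, the factor \<open>1 - d n * t\<close> turns the series for
  \<open>Suc n\<close> values into the one for \<open>n\<close> values; no values give the series
  1.\<close>

lemma complete_sym_generating_function:
  "Abs_fps (complete_sym n d) * fps_of_poly (\<Prod>j<n. [:1, - d j:]) = 1"
proof (induction n)
  case 0
  have "Abs_fps (complete_sym 0 d) = 1"
  proof (rule fps_ext)
    show "fps_nth (Abs_fps (complete_sym 0 d)) k = fps_nth 1 k" for k
      by (cases k) (simp_all add: complete_sym_0, simp add: complete_sym_def exponents_0_left)
  qed
  then show ?case by simp
next
  case (Suc n)
  have "Abs_fps (complete_sym (Suc n) d) * fps_of_poly [:1, - d n:] = Abs_fps (complete_sym n d)"
  proof (rule fps_ext)
    show "fps_nth (Abs_fps (complete_sym (Suc n) d) * fps_of_poly [:1, - d n:]) k =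
        fps_nth (Abs_fps (complete_sym n d)) k" for k
    proof -
      have "Abs_fps (complete_sym (Suc n) d) * fps_of_poly [:1, - d n:] =
        Abs_fps (complete_sym (Suc n) d) - fps_const (d n) * (fps_X * Abs_fps (complete_sym (Suc n) d))"
        by (simp add: fps_of_poly_pCons algebra_simps flip: fps_const_neg)
      then show ?thesis
        by (cases k) (simp_all add: complete_sym_0 complete_sym_Suc)
    qed
  qed
  then show ?case
    using Suc unfolding prod.lessThan_Suc fps_of_poly_mult by (metis mult.assoc mult.commute)
qed

lemma tr_sym_power_upper_triangular:
  assumes "A \<in> carrier_mat n n" "upper_triangular A"
  shows "tr_sym_power A (int k) = complete_sym n (\<lambda>j. A $$ (j, j)) k"
  using assms
  by (simp add: tr_sym_power_eq[of A n] complete_sym_def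
      sym_power_entry_diag_upper_triangular[of A n _ k] cong: sum.cong)

section \<open>Reduction to triangular matrices\<close>

text \<open>The polynomial \<open>det (1 - t A)\<close>, the reversal of the characteristic polynomial.\<close>

definition recip_char_poly :: "'a::comm_ring_1 mat \<Rightarrow> 'a poly" where
  "recip_char_poly A = det (1\<^sub>m (dim_row A) + map_mat (\<lambda>a. [:0, - a:]) A)"

text \<open>Conjugation by constant matrices fixes the identity and carries \<open>- t B\<close> to
  \<open>- t A\<close>, so \<open>1 - t A\<close> and \<open>1 - t B\<close> are similar over the
  polynomial ring.\<close>

lemma recip_char_poly_similar:
  assumes "similar_mat A B"
  shows "recip_char_poly A = recip_char_poly B"
proof -
  from similar_matD[OF assms] obtain n P Q where
    carr: "{A, B, P, Q} \<subseteq> carrier_mat n n" and PQ: "P * Q = 1\<^sub>m n" and QP: "Q * P = 1\<^sub>m n"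
    and AB: "A = P * B * Q"
    by blast
  then have A: "A \<in> carrier_mat n n" and B: "B \<in> carrier_mat n n"
    and P: "P \<in> carrier_mat n n" and Q: "Q \<in> carrier_mat n n"
    by auto
  let ?c = "map_mat (\<lambda>a. [:a:])" and ?m = "map_mat (\<lambda>a. [:0, - a:])"
  \<comment> \<open>The factor \<open>- t\<close> is split off so that it passes through products
    with constant matrices.\<close>
  have m: "?m M = map_mat (\<lambda>a. [:a:] * [:0, -1:]) M" for M :: "'a mat"
    by simp
  have one: "?c (1\<^sub>m n) = (1\<^sub>m n :: 'a poly mat)"
    by (rule eq_matI) (auto simp: one_pCons)
  have cPQ: "?c P * ?c Q = 1\<^sub>m n" and cQP: "?c Q * ?c P = 1\<^sub>m n"
    using map_poly_mult(1)[OF P Q] map_poly_mult(1)[OF Q P] by (simp_all add: PQ QP one)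
  have carr': "?c P \<in> carrier_mat n n" "?c Q \<in> carrier_mat n n" "?m B \<in> carrier_mat n n"
    using P Q B by auto
  have "?m A = ?c P * ?m B * ?c Q"
    unfolding AB m using P B Q
    by (subst map_poly_mult(2)[of _ n n _ n]) (auto simp: map_poly_mult(3)[of _ n n _ n] simp del: mult_pCons_left mult_pCons_right)
  then have "1\<^sub>m n + ?m A = ?c P * (1\<^sub>m n + ?m B) * ?c Q"
    using carr' cPQ by (simp add: mult_add_distrib_mat[of _ n n _ n] add_mult_distrib_mat[of _ n n _ _ n])
  then have "similar_mat (1\<^sub>m n + ?m A) (1\<^sub>m n + ?m B)"
    using carr' A cPQ cQP by (intro similar_matI[of _ _ "?c P" "?c Q" n]) auto
  then show ?thesis
    using det_similar A B by (auto simp: recip_char_poly_def)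
qed

lemma recip_char_poly_upper_triangular:
  assumes A: "A \<in> carrier_mat n n" and ut: "upper_triangular A"
  shows "recip_char_poly A = (\<Prod>j<n. [:1, - A $$ (j, j):])"
proof -
  let ?M = "1\<^sub>m n + map_mat (\<lambda>a. [:0, - a:]) A"
  have "upper_triangular ?M" and M: "?M \<in> carrier_mat n n"
    using A ut by (auto simp: upper_triangular_def)
  then have "det ?M = prod_list (diag_mat ?M)"
    by (rule det_upper_triangular)
  also have "\<dots> = (\<Prod>j<n. ?M $$ (j, j))"
    by (simp add: carrier_matD(1)[OF M] diag_mat_def prod.distinct_set_conv_list[symmetric] atLeast0LessThan del: index_add_mat)
  also have "\<dots> = (\<Prod>j<n. [:1, - A $$ (j, j):])"
    using A by (intro prod.cong) (auto simp: one_pCons)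
  finally show ?thesis
    using A by (simp add: recip_char_poly_def)
qed

section \<open>Triangularisation over an algebraically closed field\<close>

lemma exists_nonsingular_first_col:
  fixes v :: "'a::field vec"
  assumes v: "v \<in> carrier_vec (Suc n)" "v \<noteq> 0\<^sub>v (Suc n)"
  obtains W where "W \<in> carrier_mat (Suc n) (Suc n)" "det W \<noteq> 0" "col W 0 = v"
proof -
  interpret vec_space "TYPE('a)" "Suc n" .
  \<comment> \<open>A basis starting with \<open>v\<close> supplies the columns; independence gives
    full rank, hence a nonzero determinant.\<close>
  let ?b = "basis_completion v"
  let ?W = "mat_of_cols (Suc n) ?b"
  note b = basis_completion[OF v]
  have W: "?W \<in> carrier_mat (Suc n) (Suc n)"
    using mat_of_cols_carrier(1)[of "Suc n" ?b] b(6) by simp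
  have "rank ?W = Suc n"
    by (rule lin_indpt_full_rank[OF W]) (use b in simp_all)
  then have "det ?W \<noteq> 0"
    using det_rank_iff[OF W] by simp
  moreover have "col ?W 0 = v"
    using b(6,7) v by (cases ?b) simp_all
  ultimately show thesis
    using W that by blast
qed

text \<open>Induction on the size: in a basis that starts with an eigenvector, the first column
  vanishes below the diagonal, and the induction hypothesis handles the remaining block.\<close>

lemma similar_upper_triangular:
  fixes A :: "'a::alg_closed_field mat"
  assumes "A \<in> carrier_mat n n"
  shows "\<exists>B\<in>carrier_mat n n. upper_triangular B \<and> similar_mat A B"
  using assms
proof (induction n arbitrary: A)
  case 0
  then show ?case
    by (intro bexI[of _ A]) (auto intro: similar_mat_refl)
next
  case (Suc n)
  note A = Suc.prems
  let ?n = "Suc n"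
  have "Polynomial.degree (char_poly A) > 0"
    using degree_monic_char_poly[OF A] by simp
  then obtain e where "poly (char_poly A) e = 0"
    using alg_closed_imp_poly_has_root by blast
  then obtain v where "eigenvector A v e"
    using eigenvalue_root_char_poly[OF A] by (auto simp: eigenvalue_def)
  then have v: "v \<in> carrier_vec ?n" "v \<noteq> 0\<^sub>v ?n" and Av: "A *\<^sub>v v = e \<cdot>\<^sub>v v"
    using A by (auto simp: eigenvector_def)
  obtain W where W: "W \<in> carrier_mat ?n ?n" and "det W \<noteq> 0" and Wv: "col W 0 = v"
    using exists_nonsingular_first_col[OF v] .
  then obtain V where V: "V \<in> carrier_mat ?n ?n" and VW: "V * W = 1\<^sub>m ?n" and WV: "W * V = 1\<^sub>m ?n"
    using det_non_zero_imp_unit[OF W, of "()"] by (auto simp: Units_def ring_mat_def)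
  define C where "C = V * (A * W)"
  have C: "C \<in> carrier_mat ?n ?n"
    using V A W by (simp add: C_def)
  have "W * C * V = (W * V) * A * (W * V)"
    using W V A by (simp add: C_def assoc_mult_mat[of _ ?n ?n _ ?n _ ?n])
  also have "\<dots> = A"
    using A WV by simp
  finally have simAC: "similar_mat A C"
    using A C W V VW WV by (intro similar_matI[of _ _ W V ?n]) auto
  have "col C 0 = V *\<^sub>v (A *\<^sub>v col W 0)"
    unfolding C_def col_mult2[OF V mult_carrier_mat[OF A W] zero_less_Suc] col_mult2[OF A W zero_less_Suc] ..
  also have "\<dots> = e \<cdot>\<^sub>v (V *\<^sub>v col W 0)"
    using V v by (simp add: Wv Av mult_mat_vec[of _ ?n ?n])
  also have "V *\<^sub>v col W 0 = col (V * W) 0"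
    unfolding col_mult2[OF V W zero_less_Suc] ..
  finally have col_C: "col C 0 = e \<cdot>\<^sub>v col (1\<^sub>m ?n) 0"
    by (simp add: VW)
  have C0: "C $$ (Suc i, 0) = 0" if "i < n" for i
  proof -
    have "C $$ (Suc i, 0) = col C 0 $ Suc i"
      using C that by simp
    also have "\<dots> = 0"
      unfolding col_C using that by simp
    finally show ?thesis .
  qed
  define C1 where "C1 = mat 1 1 (\<lambda>_. C $$ (0, 0))"
  define C2 where "C2 = mat 1 n (\<lambda>(i, j). C $$ (0, Suc j))"
  define C3 where "C3 = mat n n (\<lambda>(i, j). C $$ (Suc i, Suc j))"
  have C1: "C1 \<in> carrier_mat 1 1" and C2: "C2 \<in> carrier_mat 1 n" and C3: "C3 \<in> carrier_mat n n"
    by (simp_all add: C1_def C2_def C3_def)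
  have C_block: "C = four_block_mat C1 C2 (0\<^sub>m n 1) C3"
  proof (rule eq_matI)
    fix i j
    assume "i < dim_row (four_block_mat C1 C2 (0\<^sub>m n 1) C3)"
      "j < dim_col (four_block_mat C1 C2 (0\<^sub>m n 1) C3)"
    then show "C $$ (i, j) = four_block_mat C1 C2 (0\<^sub>m n 1) C3 $$ (i, j)"
      using C0 by (cases i; cases j) (auto simp: C1_def C2_def C3_def)
  qed (use C C1 C3 in auto)
  obtain B3 where B3: "B3 \<in> carrier_mat n n" "upper_triangular B3" "similar_mat C3 B3"
    using Suc.IH[OF C3] by blast
  \<comment> \<open>The similarity of the lower right blocks extends to the whole matrix, changing
    otherwise only the upper right block.\<close>
  obtain B2 where "B2 \<in> carrier_mat 1 n"
    and sim: "similar_mat C (four_block_mat C1 B2 (0\<^sub>m n 1) B3)"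
    using similar_mat_four_block_0_ex[OF similar_mat_refl[OF C1] B3(3) C2 C1 C3]
    unfolding C_block by blast
  have "upper_triangular (four_block_mat C1 B2 (0\<^sub>m n 1) B3)"
    by (rule upper_triangular_four_block[OF C1 B3(1) _ B3(2)]) (simp add: C1_def upper_triangular_def)
  moreover have "four_block_mat C1 B2 (0\<^sub>m n 1) B3 \<in> carrier_mat ?n ?n"
    using C1 B3(1) by (auto simp: four_block_mat_def Let_def)
  ultimately show ?case
    using similar_mat_trans[OF simAC sim] by blast
qed

text \<open>Both factors are similarity invariants; on a triangular representative they are the
  complete symmetric series of the diagonal entries and its inverse.\<close>

lemma tr_sym_power_generating_function_alg_closed:
  fixes A :: "'a::alg_closed_field mat"
  assumes A: "A \<in> carrier_mat n n"
  shows "Abs_fps (\<lambda>k. tr_sym_power A (int k)) * fps_of_poly (recip_char_poly A) = 1"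
proof -
  obtain B where "B \<in> carrier_mat n n" "upper_triangular B" "similar_mat A B"
    using similar_upper_triangular[OF A] by blast
  then show ?thesis
    using complete_sym_generating_function[of n "\<lambda>j. B $$ (j, j)"]
    by (simp add: tr_sym_power_similar recip_char_poly_similar
        tr_sym_power_upper_triangular recip_char_poly_upper_triangular)
qed

section \<open>Descent from the algebraic closure to the base field\<close>

interpretation to_ac: inj_comm_ring_hom to_ac
  by unfold_locales auto

abbreviation (input) map_ac :: "'a::field mpolynomial \<Rightarrow> 'a alg_closure mpolynomial" where
  "map_ac \<equiv> Poly_Mapping.map to_ac"

lemma lookup_map_ac: "Poly_Mapping.lookup (map_ac p) k = to_ac (Poly_Mapping.lookup p k)"
  by (simp add: Poly_Mapping.map.rep_eq when_def)

lemma map_ac_single: "map_ac (Poly_Mapping.single k c) = Poly_Mapping.single k (to_ac c)"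
  by (rule poly_mapping_eqI) (simp add: lookup_map_ac lookup_single when_def)

lemma map_ac_add: "map_ac (p + q) = map_ac p + map_ac q"
  by (rule poly_mapping_eqI) (simp add: lookup_map_ac lookup_add)

lemma map_ac_sum: "map_ac (\<Sum>x\<in>S. f x) = (\<Sum>x\<in>S. map_ac (f x))"
  by (rule poly_mapping_eqI) (simp add: lookup_map_ac lookup_sum to_ac_sum)

lemma map_ac_mult: "map_ac (p * q) = map_ac p * map_ac q"
proof (induction p rule: poly_mapping_add_induct)
  case (single k c)
  show ?case
    by (induction q rule: poly_mapping_add_induct)
      (simp_all add: mult_single map_ac_single map_ac_add algebra_simps)
qed (simp add: map_ac_add algebra_simps)

lemma map_ac_one: "map_ac 1 = 1"
  using map_ac_single[of 0 1] by simp

lemma map_ac_power: "map_ac (p ^ m) = map_ac p ^ m"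
  by (induction m) (simp_all add: map_ac_one map_ac_mult)

lemma map_ac_prod: "map_ac (\<Prod>x\<in>S. f x) = (\<Prod>x\<in>S. map_ac (f x))"
  by (induction S rule: infinite_finite_induct) (simp_all add: map_ac_one map_ac_mult)

lemma map_ac_image_var:
  "A \<in> carrier_mat n n \<Longrightarrow> j < n \<Longrightarrow> map_ac (image_var A j) = image_var (map_mat to_ac A) j"
  by (auto simp: image_var_def map_ac_sum map_ac_single intro!: sum.cong)

text \<open>The entries of \<open>S^k A\<close> arise from those of \<open>A\<close> by sums and
  products, which the embedding preserves.\<close>

lemma tr_sym_power_map_ac:
  assumes "A \<in> carrier_mat n n"
  shows "tr_sym_power (map_mat to_ac A) (int k) = to_ac (tr_sym_power A (int k))"
proof -
  have "sym_power_entry (map_mat to_ac A) \<alpha> \<beta> = to_ac (sym_power_entry A \<alpha> \<beta>)" for \<alpha> \<beta>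
    using assms
    by (simp add: sym_power_entry_eq map_ac_prod map_ac_power map_ac_image_var flip: lookup_map_ac)
  then show ?thesis
    using assms by (simp add: tr_sym_power_eq[of _ n] to_ac_sum)
qed

lemma recip_char_poly_map_ac:
  assumes "A \<in> carrier_mat n n"
  shows "recip_char_poly (map_mat to_ac A) = map_poly to_ac (recip_char_poly A)"
proof -
  interpret map_poly_comm_ring_hom to_ac ..
  have "1\<^sub>m n + map_mat (\<lambda>a. [:0, - a:]) (map_mat to_ac A) =
      map_mat (map_poly to_ac) (1\<^sub>m n + map_mat (\<lambda>a. [:0, - a:]) A)"
    using assms by (intro eq_matI) (auto simp: hom_distribs)
  then show ?thesis
    using assms hom_det by (simp add: recip_char_poly_def)
qed

text \<open>The coefficients agree in the algebraic closure, and the embedding is injective.\<close>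

lemma tr_sym_power_generating_function:
  fixes A :: "'a::field mat"
  assumes A: "A \<in> carrier_mat n n"
  shows "Abs_fps (\<lambda>k. tr_sym_power A (int k)) * fps_of_poly (recip_char_poly A) = 1"
proof (rule fps_ext)
  fix k
  let ?F = "\<lambda>B. Abs_fps (\<lambda>k. tr_sym_power B (int k)) * fps_of_poly (recip_char_poly B)"
  have "to_ac (fps_nth (?F A) k) = fps_nth (?F (map_mat to_ac A)) k"
    using A by (simp add: fps_mult_nth to_ac_sum tr_sym_power_map_ac recip_char_poly_map_ac coeff_map_poly)
  also have "\<dots> = fps_nth 1 k"
    using A by (subst tr_sym_power_generating_function_alg_closed[of _ n]) auto
  also have "\<dots> = to_ac (fps_nth 1 k)"
    by simp
  finally show "fps_nth (?F A) k = fps_nth 1 k"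
    by (simp only: to_ac_eq_iff)
qed

section \<open>The adjugate of \<open>1 - t A\<close>\<close>

interpretation fps_of_poly: comm_ring_hom "fps_of_poly :: 'a::comm_ring_1 poly \<Rightarrow> 'a fps"
  by unfold_locales (simp_all add: fps_of_poly_add fps_of_poly_mult)

text \<open>Up to sign, an entry of the adjugate is a minor of size \<open>n - 1\<close> with
  entries that are at most linear.\<close>

lemma degree_adj_mat_le:
  assumes M: "M \<in> carrier_mat n n" and deg: "\<And>i j. i < n \<Longrightarrow> j < n \<Longrightarrow> Polynomial.degree (M $$ (i, j)) \<le> 1"
    and ij: "i < n" "j < n"
  shows "Polynomial.degree (adj_mat M $$ (i, j)) < n"
proof -
  have del: "mat_delete M j i \<in> carrier_mat (n - 1) (n - 1)"
    using M by (rule mat_delete_carrier)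
  have "Polynomial.degree (mat_delete M j i $$ (k, l)) \<le> 1" if "k < n - 1" "l < n - 1" for k l
    using M that deg by (auto simp: mat_delete_def)
  then have "Polynomial.degree (det (mat_delete M j i)) \<le> 1 * (n - 1)"
    using del by (rule degree_det_le)
  moreover have "adj_mat M $$ (i, j) = (-1) ^ (j + i) * det (mat_delete M j i)"
    using M ij by (simp add: adj_mat_def cofactor_def)
  ultimately show ?thesis
    using ij by (cases "even (j + i)") simp_all
qed

text \<open>The sum is the coefficient of \<open>t^m\<close> in an entry of the adjugate of
  \<open>1 - t A\<close>, which has degree below \<open>n\<close>. For \<open>m = n\<close> this is
  the Cayley-Hamilton theorem.\<close>

lemma recip_char_poly_mat_power:
  assumes A: "A \<in> carrier_mat n n" and ij: "i < n" "j < n" and m: "n \<le> m"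
  shows "(\<Sum>l=0..m. Polynomial.coeff (recip_char_poly A) l * (A ^\<^sub>m (m - l)) $$ (i, j)) = 0"
proof -
  define M where "M = 1\<^sub>m n + map_mat (\<lambda>a. [:0, - a:]) A"
  \<comment> \<open>\<open>M\<close> is \<open>1 - t A\<close> and \<open>G\<close> its inverse over the power series.\<close>
  define G where "G = mat n n (\<lambda>(i, j). Abs_fps (\<lambda>m. (A ^\<^sub>m m) $$ (i, j)))"
  let ?F = "map_mat fps_of_poly :: 'a poly mat \<Rightarrow> 'a fps mat"
  have M: "M \<in> carrier_mat n n" and G: "G \<in> carrier_mat n n"
    using A by (auto simp: M_def G_def)
  note adj = adj_mat[OF M]
  have D: "recip_char_poly A = det M"
    using A by (simp add: recip_char_poly_def M_def)
  have "G * ?F M = 1\<^sub>m n"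
  proof (rule eq_matI)
    fix i j assume "i < dim_row (1\<^sub>m n :: 'a fps mat)" "j < dim_col (1\<^sub>m n :: 'a fps mat)"
    then have ij: "i < n" "j < n" by auto
    have entry: "?F M $$ (l, j) = (if l = j then 1 else 0) - fps_X * fps_const (A $$ (l, j))" if "l < n" for l
      using A ij that by (simp add: M_def fps_of_poly_pCons fps_of_poly_add)
    have "(G * ?F M) $$ (i, j) = (\<Sum>l<n. G $$ (i, l) * ?F M $$ (l, j))"
      using G M ij by (simp add: scalar_prod_def atLeast0LessThan)
    also have "\<dots> = (\<Sum>l<n. (if l = j then G $$ (i, l) else 0) - fps_X * (G $$ (i, l) * fps_const (A $$ (l, j))))"
      by (intro sum.cong) (auto simp: entry algebra_simps simp del: index_map_mat)
    also have "\<dots> = G $$ (i, j) - fps_X * (\<Sum>l<n. G $$ (i, l) * fps_const (A $$ (l, j)))"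
      using ij by (simp add: sum_subtractf sum_distrib_left)
    \<comment> \<open>Coefficient 0 is an entry of \<open>A^0 = 1\<close>; coefficient
      \<open>k' + 1\<close> is one of \<open>A^(k' + 1) - A^k' A = 0\<close>.\<close>
    also have "\<dots> = 1\<^sub>m n $$ (i, j)"
    proof (rule fps_ext)
      show "fps_nth (G $$ (i, j) - fps_X * (\<Sum>l<n. G $$ (i, l) * fps_const (A $$ (l, j)))) k =
          fps_nth (1\<^sub>m n $$ (i, j)) k" for k
      proof (cases k)
        case 0
        then show ?thesis using A ij by (simp add: G_def)
      next
        case (Suc k')
        have "(A ^\<^sub>m k' * A) $$ (i, j) = (\<Sum>l<n. (A ^\<^sub>m k') $$ (i, l) * A $$ (l, j))"
          using pow_carrier_mat[OF A, of k'] A ij by (simp add: scalar_prod_def atLeast0LessThan)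
        then show ?thesis
          using Suc ij by (simp add: G_def fps_sum_nth)
      qed
    qed
    finally show "(G * ?F M) $$ (i, j) = 1\<^sub>m n $$ (i, j)" .
  qed (use G M in auto)
  moreover have "?F M * ?F (adj_mat M) = fps_of_poly (det M) \<cdot>\<^sub>m 1\<^sub>m n"
  proof -
    have "?F M * ?F (adj_mat M) = ?F (det M \<cdot>\<^sub>m 1\<^sub>m n)"
      using fps_of_poly.mat_hom_mult[OF M adj(1)] adj(2) by simp
    also have "\<dots> = fps_of_poly (det M) \<cdot>\<^sub>m 1\<^sub>m n"
      by (rule eq_matI) (auto simp: fps_of_poly_mult)
    finally show ?thesis .
  qed
  \<comment> \<open>\<open>G\<close> is a left inverse of \<open>M\<close>, and \<open>M\<close>
    times its adjugate is the scalar \<open>det M\<close>; associativity makes the adjugate equal to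
    \<open>det M\<close> times \<open>G\<close>.\<close>
  moreover have "(G * ?F M) * ?F (adj_mat M) = G * (?F M * ?F (adj_mat M))"
    using G M adj(1) by (intro assoc_mult_mat) auto
  ultimately have "?F (adj_mat M) = fps_of_poly (det M) \<cdot>\<^sub>m G"
    using G adj(1) mult_smult_distrib[OF G one_carrier_mat, of "fps_of_poly (det M)"] by simp
  then have "fps_of_poly (adj_mat M $$ (i, j)) = fps_of_poly (recip_char_poly A) * G $$ (i, j)"
    using ij adj(1) G D by (metis carrier_matD index_map_mat(1) index_smult_mat(1))
  then have "fps_nth (fps_of_poly (recip_char_poly A) * G $$ (i, j)) m = Polynomial.coeff (adj_mat M $$ (i, j)) m"
    by (metis fps_of_poly_nth)
  also have "Polynomial.degree (adj_mat M $$ (i, j)) < n"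
    by (rule degree_adj_mat_le[OF M _ ij]) (use A in \<open>simp add: M_def one_pCons\<close>)
  then have "Polynomial.coeff (adj_mat M $$ (i, j)) m = 0"
    using m by (simp add: Polynomial.coeff_eq_0)
  finally show ?thesis
    using ij by (simp add: fps_mult_nth G_def)
qed

section \<open>Linear functionals and the comparison of power series\<close>

lemma linear_functional_mat_sum:
  assumes f: "linear_functional_mat n f" and M: "\<And>l. M l \<in> carrier_mat n n" and "finite S"
  shows "f (mat n n (\<lambda>(i, j). \<Sum>l\<in>S. c l * M l $$ (i, j))) = (\<Sum>l\<in>S. c l * f (M l))"
  using \<open>finite S\<close>
proof induction
  case empty
  \<comment> \<open>Homogeneity with scalar 0 gives the value 0 at the zero matrix.\<close>
  have "f (0 \<cdot>\<^sub>m 0\<^sub>m n n) = 0 * f (0\<^sub>m n n)"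
    using f by (simp only: linear_functional_mat_def zero_carrier_mat)
  moreover have "mat n n (\<lambda>(i, j). \<Sum>l\<in>{}. c l * M l $$ (i, j)) = 0 \<cdot>\<^sub>m 0\<^sub>m n n"
    by (rule eq_matI) auto
  ultimately show ?case
    by (simp only: sum.empty mult_zero_left)
next
  case (insert x S)
  have eq: "mat n n (\<lambda>(i, j). \<Sum>l\<in>insert x S. c l * M l $$ (i, j)) =
      c x \<cdot>\<^sub>m M x + mat n n (\<lambda>(i, j). \<Sum>l\<in>S. c l * M l $$ (i, j))"
    using insert M[of x] by (intro eq_matI) auto
  have "f (mat n n (\<lambda>(i, j). \<Sum>l\<in>insert x S. c l * M l $$ (i, j))) =
      c x * f (M x) + f (mat n n (\<lambda>(i, j). \<Sum>l\<in>S. c l * M l $$ (i, j)))"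
    unfolding eq using f M by (simp add: linear_functional_mat_def)
  also have "\<dots> = (\<Sum>l\<in>insert x S. c l * f (M l))"
    by (simp only: insert.IH sum.insert[OF insert.hyps])
  finally show ?case .
qed

lemma linear_functional_recip_char_poly:
  assumes A: "A \<in> carrier_mat n n" and f: "linear_functional_mat n f" and m: "n \<le> m"
  shows "(\<Sum>l=0..m. Polynomial.coeff (recip_char_poly A) l * f (A ^\<^sub>m (m - l))) = 0"
proof -
  let ?c = "Polynomial.coeff (recip_char_poly A)"
  have "(\<Sum>l=0..m. ?c l * f (A ^\<^sub>m (m - l))) =
      f (mat n n (\<lambda>(i, j). \<Sum>l=0..m. ?c l * (A ^\<^sub>m (m - l)) $$ (i, j)))"
    by (rule linear_functional_mat_sum[OF f, symmetric]) (use A in auto)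
  \<comment> \<open>The combination is the zero matrix, written as an empty sum so that
    \<open>linear_functional_mat_sum\<close> evaluates it as well.\<close>
  also have "mat n n (\<lambda>(i, j). \<Sum>l=0..m. ?c l * (A ^\<^sub>m (m - l)) $$ (i, j)) =
      mat n n (\<lambda>(i, j). \<Sum>l\<in>{}. ?c l * (A ^\<^sub>m (m - l)) $$ (i, j))"
    using recip_char_poly_mat_power[OF A _ _ m] by (intro eq_matI) auto
  also have "f \<dots> = (\<Sum>l\<in>{}. ?c l * f (A ^\<^sub>m (m - l)))"
    by (rule linear_functional_mat_sum[OF f]) (use A in auto)
  finally show ?thesis by simp
qed

lemma tr_sym_power_0: "tr_sym_power A 0 = 1"
  by (simp add: tr_sym_power_def exponents_0_right sym_power_entry_eq)

text \<open>The bound \<open>k \<ge> -1\<close> makes \<open>k + 1\<close> a natural exponent; the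
  example before \<open>tr_sym_power\<close> rules out inverse powers.\<close>

theorem theorem3p1:
  fixes n :: nat
    and A :: "'a::field mat"
    and \<sigma> :: "nat \<Rightarrow> 'a mat \<Rightarrow> 'a"
  assumes A: "A \<in> carrier_mat n n"
    and linear: "linear_functional_mat n (\<sigma> 1)"
    and vanishes: "\<sigma> 1 (1\<^sub>m n) = 0"
    and recursion: "\<And>B m. B \<in> carrier_mat n n \<Longrightarrow> 2 \<le> m \<Longrightarrow> m \<le> n - 1 \<Longrightarrow>
      \<sigma> 1 (B ^\<^sub>m m) = (\<Sum>i=1..m. (-1) ^ (i - 1) * \<sigma> i B * tr_sym_power B (int m - int i))"
  shows "(\<forall>k::int. k \<ge> -1 \<longrightarrow>
           \<sigma> 1 (A ^\<^sub>m nat (k + 1)) =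
             (\<Sum>i=1..n-1. (-1) ^ (i - 1) * \<sigma> i A * tr_sym_power A (k - int i + 1))) \<and>
         (\<sigma> 1 A \<noteq> 0 \<longrightarrow> (\<forall>k::int. k \<ge> -1 \<longrightarrow>
           tr_sym_power A k = 1 / \<sigma> 1 A *
             (\<sigma> 1 (A ^\<^sub>m nat (k + 1)) +
               (\<Sum>i=2..n-1. (-1) ^ i * \<sigma> i A * tr_sym_power A (k - int i + 1)))))"
proof -
  define H where "H = Abs_fps (\<lambda>k. tr_sym_power A (int k))"
  define D where "D = fps_of_poly (recip_char_poly A)"
  define a where "a = Abs_fps (\<lambda>m. \<sigma> 1 (A ^\<^sub>m m))"
  define P where "P = Abs_fps (\<lambda>i. if i \<in> {1..n-1} then (-1) ^ (i - 1) * \<sigma> i A else 0)"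
  have HD: "H * D = 1"
    unfolding H_def D_def by (rule tr_sym_power_generating_function[OF A])
  have PH: "fps_nth (P * H) m = (\<Sum>i=1..n-1. (-1) ^ (i - 1) * \<sigma> i A * tr_sym_power A (int m - int i))" for m
  proof -
    have "fps_nth (P * H) m = (\<Sum>i=0..m. fps_nth P i * tr_sym_power A (int m - int i))"
      by (simp add: fps_mult_nth H_def of_nat_diff)
    \<comment> \<open>Indices \<open>i > m\<close> add only traces in negative degree, which are 0.
      Afterwards the indices outside \<open>{1..n-1}\<close> drop out because \<open>P\<close>
      vanishes there.\<close>
    also have "\<dots> = (\<Sum>i\<in>{0..m} \<union> {1..n-1}. fps_nth P i * tr_sym_power A (int m - int i))"
      by (rule sum.mono_neutral_left) (auto simp: tr_sym_power_neg)
    also have "\<dots> = (\<Sum>i=1..n-1. fps_nth P i * tr_sym_power A (int m - int i))"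
      by (rule sum.mono_neutral_right) (auto simp: P_def)
    finally show ?thesis by (simp add: P_def)
  qed
  \<comment> \<open>Degree 0 is the vanishing on the identity, degree 1 is
    \<open>tr (S^0 A) = 1\<close>, and the other degrees are the recursion.\<close>
  have low: "fps_nth a m = fps_nth (P * H) m" if m: "m \<le> n - 1" for m
  proof -
    consider "m = 0" | "m = 1" | "2 \<le> m" by linarith
    then show ?thesis
    proof cases
      case 1
      then show ?thesis
        using A vanishes by (simp add: a_def P_def)
    next
      case 2
      then show ?thesis
        using A m by (simp add: fps_mult_nth a_def P_def H_def tr_sym_power_0)
    next
      case 3
      have "(\<Sum>i=1..m. (-1) ^ (i - 1) * \<sigma> i A * tr_sym_power A (int m - int i)) =
          (\<Sum>i=1..n-1. (-1) ^ (i - 1) * \<sigma> i A * tr_sym_power A (int m - int i))"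
        by (rule sum.mono_neutral_left) (use m in \<open>auto simp: tr_sym_power_neg\<close>)
      then show ?thesis
        using recursion[OF A 3 m] by (simp add: PH a_def)
    qed
  qed
  \<comment> \<open>Coefficients of \<open>D * a\<close> up to degree \<open>n - 1\<close> involve
    only those of \<open>a\<close> in this range, where \<open>a\<close> may be replaced by
    \<open>P * H\<close>. Beyond it both sides vanish.\<close>
  have "D * a = P"
  proof (rule fps_ext)
    fix m
    show "fps_nth (D * a) m = fps_nth P m"
    proof (cases "m \<le> n - 1")
      case True
      then have "fps_nth (D * a) m = fps_nth (D * (P * H)) m"
        by (simp add: fps_mult_nth[of D] low)
      also have "D * (P * H) = P"
        using HD by (metis mult.assoc mult.commute mult_1_left)
      finally show ?thesis .
    next
      case False
      then have "fps_nth (D * a) m = 0"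
        using linear_functional_recip_char_poly[OF A linear, of m]
        by (simp add: fps_mult_nth D_def a_def)
      then show ?thesis
        using False by (simp add: P_def)
    qed
  qed
  then have "a = P * H"
    using HD by (metis mult.assoc mult.commute mult_1_left)
  have main: "\<sigma> 1 (A ^\<^sub>m m) =
      (\<Sum>i=1..n-1. (-1) ^ (i - 1) * \<sigma> i A * tr_sym_power A (int m - int i))" for m
    using PH[of m] arg_cong[OF \<open>a = P * H\<close>, of "\<lambda>f. fps_nth f m"] by (simp add: a_def)
  have first: "\<sigma> 1 (A ^\<^sub>m nat (k + 1)) =
      (\<Sum>i=1..n-1. (-1) ^ (i - 1) * \<sigma> i A * tr_sym_power A (k - int i + 1))" if "k \<ge> -1" for k :: int
    using main[of "nat (k + 1)"] that by (simp add: algebra_simps)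
  have second: "tr_sym_power A k = 1 / \<sigma> 1 A *
      (\<sigma> 1 (A ^\<^sub>m nat (k + 1)) + (\<Sum>i=2..n-1. (-1) ^ i * \<sigma> i A * tr_sym_power A (k - int i + 1)))"
    if "k \<ge> -1" and nz: "\<sigma> 1 A \<noteq> 0" for k :: int
  proof -
    \<comment> \<open>For \<open>n \<le> 1\<close> the sum in \<open>main\<close> is empty, which at
      exponent 1 would force \<open>\<sigma> 1 A = 0\<close>.\<close>
    have n: "1 \<le> n - 1"
    proof (rule ccontr)
      assume "\<not> 1 \<le> n - 1"
      then show False
        using nz main[of 1] A by simp
    qed
    have "\<sigma> 1 (A ^\<^sub>m nat (k + 1)) = \<sigma> 1 A * tr_sym_power A k +
        (\<Sum>i=2..n-1. (-1) ^ (i - 1) * \<sigma> i A * tr_sym_power A (k - int i + 1))"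
      unfolding first[OF \<open>k \<ge> -1\<close>] sum.atLeast_Suc_atMost[OF n] by (simp add: numeral_2_eq_2)
    also have "(\<Sum>i=2..n-1. (-1) ^ (i - 1) * \<sigma> i A * tr_sym_power A (k - int i + 1)) =
        - (\<Sum>i=2..n-1. (-1) ^ i * \<sigma> i A * tr_sym_power A (k - int i + 1))"
      unfolding sum_negf[symmetric]
    proof (rule sum.cong)
      fix i assume "i \<in> {2..n-1}"
      \<comment> \<open>Since \<open>i\<close> is positive, \<open>i - 1\<close> is not truncated
        and the signs differ by one factor \<open>-1\<close>.\<close>
      then obtain j where "i = Suc j" by (cases i) auto
      then show "(-1) ^ (i - 1) * \<sigma> i A * tr_sym_power A (k - int i + 1) =
          - ((-1) ^ i * \<sigma> i A * tr_sym_power A (k - int i + 1))"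
        by simp
    qed simp
    finally show ?thesis
      using nz by simp
  qed
  show ?thesis
    using first second by blast
qed

end
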